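(* Let $m\ge1$ and let $\mathsf{P}(A)\in\mathcal{P}_f(\mathbb{T}^m)$ be the graph of a toral automorphism $A\in\mathrm{GL}(m,\mathbb{Z})$. For every finite subgroup $H\subset\mathbb{T}^m$ there exists a finite subgroup $H'\subset\mathbb{T}^m$ containing $H$ which is doubly invariant under $\Pi_{\mathsf{P}(A)}$. In particular, $\mathsf{P}(A)_{H'}$ is the graph of an automorphism of $\mathbb{T}^m/H'$. In other words, if a polymorphism is a factor of a toral automorphism then it has a further factor which is again an automorphism.
   Context: A correspondence of a compact group $G$ is a closed subgroup $\mathsf{P}\subset G\times G$ both of whose coordinate projections onto $G$ are surjective. Its polymorphism is $\Pi_{\mathsf{P}}(x)=\{y:(x,y)\in\mathsf{P}\}$. $\mathcal{P}_f(\mathbb{T}^m)$ denotes the set of correspondences $\mathsf{P}$ of $\mathbb{T}^m=\mathbb{R}^m/\mathbb{Z}^m$ that are finite-to-one, i.e. such that $\{x:(x,0)\in\mathsf{P}\}$ and $\{y:(0,y)\in\mathsf{P}\}$ are finite. For $A\in\mathrm{GL}(m,\mathbb{Z})$, $\mathsf{P}(A)=\{(x,Ax):x\in\mathbb{T}^m\}$. For a correspondence $\mathsf{P}$ of a compact group $G$ and a closed normal subgroup $H\subset G$, $\mathsf{P}_H=\mathsf{P}/(H\times H)\subset G/H\times G/H$ is the image of $\mathsf{P}$ under the quotient map (the factor correspondence). $H$ is doubly invariant under $\Pi_{\mathsf{P}}$ if $\mathsf{P}_H$ is the graph of a continuous automorphism of $G/H$. A correspondence $\mathsf{P}'$ of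 $G'$ is a factor of a correspondence $\mathsf{P}$ of $G$ (and $\Pi_{\mathsf{P}'}$ is a factor of $\Pi_{\mathsf{P}}$) if there is a continuous surjective homomorphism $\phi\colon G\to G'$ with $(\phi\times\phi)(\mathsf{P})=\mathsf{P}'$. The final "in other words" sentence rephrases the first assertion: the factor $\mathsf{P}(A)_H$ of $\mathsf{P}(A)$, with $H$ finite, has the graph of an automorphism, $\mathsf{P}(A)_{H'}$, as a further factor. *)

theory Defs
  imports "HOL-Analysis.Analysis" "HOL-Algebra.Coset"
begin

section \<open>Compact groups and their quotients\<close>

text \<open>A topological group is a group \<open>G\<close> in the sense of HOL-Algebra together with a topology \<open>T\<close>
  on its carrier. Compact groups are Hausdorff by convention.\<close>

locale topological_group = group G for G (structure) and T :: "'a topology" +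
  assumes topspace_eq: "topspace T = carrier G"
    and continuous_mult: "continuous_map (prod_topology T T) T (\<lambda>(x, y). x \<otimes> y)"
    and continuous_inv: "continuous_map T T (\<lambda>x. inv x)"

locale compact_group = topological_group +
  assumes compact: "compact_space T"
    and Hausdorff: "Hausdorff_space T"

definition quotient_topology :: "'a monoid \<Rightarrow> 'a topology \<Rightarrow> 'a set \<Rightarrow> 'a set topology" where
  "quotient_topology G T H =
     topology (\<lambda>U. U \<subseteq> carrier (G Mod H) \<and> openin T {x \<in> topspace T. H #>\<^bsub>G\<^esub> x \<in> U})"

lemma openin_quotient_topology:
  "openin (quotient_topology G T H) U \<longleftrightarrow>
     U \<subseteq> carrier (G Mod H) \<and> openin T {x \<in> topspace T. H #>\<^bsub>G\<^esub> x \<in> U}"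
proof -
  have "istopology (\<lambda>U. U \<subseteq> carrier (G Mod H) \<and> openin T {x \<in> topspace T. H #>\<^bsub>G\<^esub> x \<in> U})"
    unfolding istopology_def
  proof (intro conjI allI impI)
    fix S U
    assume "S \<subseteq> carrier (G Mod H) \<and> openin T {x \<in> topspace T. H #>\<^bsub>G\<^esub> x \<in> S}"
      and "U \<subseteq> carrier (G Mod H) \<and> openin T {x \<in> topspace T. H #>\<^bsub>G\<^esub> x \<in> U}"
    moreover have "{x \<in> topspace T. H #>\<^bsub>G\<^esub> x \<in> S \<inter> U} =
        {x \<in> topspace T. H #>\<^bsub>G\<^esub> x \<in> S} \<inter> {x \<in> topspace T. H #>\<^bsub>G\<^esub> x \<in> U}"
      by auto
    ultimately show "S \<inter> U \<subseteq> carrier (G Mod H)"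
      and "openin T {x \<in> topspace T. H #>\<^bsub>G\<^esub> x \<in> S \<inter> U}"
      by auto
  next
    fix K
    assume K: "\<forall>S\<in>K. S \<subseteq> carrier (G Mod H) \<and> openin T {x \<in> topspace T. H #>\<^bsub>G\<^esub> x \<in> S}"
    then show "\<Union>K \<subseteq> carrier (G Mod H)"
      by blast
    have "{x \<in> topspace T. H #>\<^bsub>G\<^esub> x \<in> \<Union>K} = (\<Union>S\<in>K. {x \<in> topspace T. H #>\<^bsub>G\<^esub> x \<in> S})"
      by auto
    then show "openin T {x \<in> topspace T. H #>\<^bsub>G\<^esub> x \<in> \<Union>K}"
      using K by auto
  qed
  then show ?thesis
    by (simp add: quotient_topology_def)
qed

definition topological_automorphism :: "'a monoid \<Rightarrow> 'a topology \<Rightarrow> ('a \<Rightarrow> 'a) \<Rightarrow> bool" where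
  "topological_automorphism G T f \<longleftrightarrow> f \<in> iso G G \<and> continuous_map T T f"

definition graph_of :: "'a monoid \<Rightarrow> ('a \<Rightarrow> 'a) \<Rightarrow> ('a \<times> 'a) set" where
  "graph_of G f = {(x, f x) | x. x \<in> carrier G}"


section \<open>Correspondences\<close>

text \<open>A correspondence \<open>P\<close> is identified with its polymorphism, the multivalued map
  \<open>x \<mapsto> P `` {x}\<close>.\<close>

definition correspondence :: "'a monoid \<Rightarrow> 'a topology \<Rightarrow> ('a \<times> 'a) set \<Rightarrow> bool" where
  "correspondence G T P \<longleftrightarrow>
     compact_group G T \<and> subgroup P (G \<times>\<times> G) \<and> closedin (prod_topology T T) P \<and>
     fst ` P = carrier G \<and> snd ` P = carrier G"

definition finite_to_one_correspondences ::
    "'a monoid \<Rightarrow> 'a topology \<Rightarrow> ('a \<times> 'a) set set" where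
  "finite_to_one_correspondences G T =
     {P. correspondence G T P \<and> finite {x. (x, \<one>\<^bsub>G\<^esub>) \<in> P} \<and> finite {y. (\<one>\<^bsub>G\<^esub>, y) \<in> P}}"

definition factor_correspondence ::
    "'a monoid \<Rightarrow> ('a \<times> 'a) set \<Rightarrow> 'a set \<Rightarrow> ('a set \<times> 'a set) set" where
  "factor_correspondence G P H = map_prod (\<lambda>x. H #>\<^bsub>G\<^esub> x) (\<lambda>x. H #>\<^bsub>G\<^esub> x) ` P"

definition doubly_invariant ::
    "'a monoid \<Rightarrow> 'a topology \<Rightarrow> ('a \<times> 'a) set \<Rightarrow> 'a set \<Rightarrow> bool" where
  "doubly_invariant G T P H \<longleftrightarrow>
     H \<lhd> G \<and> closedin T H \<and>
     (\<exists>f. topological_automorphism (G Mod H) (quotient_topology G T H) f \<and>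
          factor_correspondence G P H = graph_of (G Mod H) f)"

text \<open>\<open>is_factor G' T' P' G T P\<close>: the correspondence \<open>P'\<close> of \<open>G'\<close> is a factor of the
  correspondence \<open>P\<close> of \<open>G\<close>.\<close>

definition is_factor ::
    "'b monoid \<Rightarrow> 'b topology \<Rightarrow> ('b \<times> 'b) set \<Rightarrow> 'a monoid \<Rightarrow> 'a topology \<Rightarrow> ('a \<times> 'a) set \<Rightarrow> bool"
  where
  "is_factor G' T' P' G T P \<longleftrightarrow>
     correspondence G T P \<and> correspondence G' T' P' \<and>
     (\<exists>\<phi>. \<phi> \<in> hom G G' \<and> continuous_map T T' \<phi> \<and> \<phi> ` carrier G = carrier G' \<and>
          map_prod \<phi> \<phi> ` P = P')"


section \<open>The torus and its automorphisms\<close>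

definition vector_group :: "(real ^ 'n) monoid" where
  "vector_group = \<lparr>carrier = UNIV, mult = (+), one = 0\<rparr>"

definition integer_lattice :: "(real ^ 'n) set" where
  "integer_lattice = {v. \<forall>i. v $ i \<in> \<int>}"

definition torus :: "(real ^ 'n) set monoid" where
  "torus = vector_group Mod integer_lattice"

definition torus_topology :: "(real ^ 'n) set topology" where
  "torus_topology = quotient_topology vector_group euclidean integer_lattice"

definition torus_proj :: "real ^ 'n \<Rightarrow> (real ^ 'n) set" where
  "torus_proj v = integer_lattice #>\<^bsub>vector_group\<^esub> v"

text \<open>The map of the torus induced by an integer matrix; the union below is over equal cosets,
  see \<open>toral_map_proj\<close>.\<close>

definition toral_map :: "int ^ 'n ^ 'n \<Rightarrow> (real ^ 'n) set \<Rightarrow> (real ^ 'n) set" where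
  "toral_map A X = (\<Union>v\<in>X. torus_proj (map_matrix real_of_int A *v v))"

lemma torus_proj_eq: "torus_proj v = {w. w - v \<in> integer_lattice}"
proof -
  have "w \<in> (\<lambda>h. h + v) ` integer_lattice \<longleftrightarrow> w - v \<in> integer_lattice" for w
    by (metis (no_types, lifting) add_diff_cancel diff_add_cancel image_iff)
  then show ?thesis
    by (auto simp: torus_proj_def r_coset_def vector_group_def)
qed

lemma carrier_torus: "carrier torus = range torus_proj"
  by (auto simp: torus_def carrier_FactGroup torus_proj_def vector_group_def)

lemma toral_map_proj:
  fixes A :: "int ^ 'n ^ 'n"
  shows "toral_map A (torus_proj v) = torus_proj (map_matrix real_of_int A *v v)"
proof -
  let ?A = "map_matrix real_of_int A"
  have lat: "?A *v u \<in> integer_lattice" if "u \<in> integer_lattice" for u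
    using that by (auto simp: integer_lattice_def matrix_vector_mult_def map_matrix_def
        intro!: Ints_sum Ints_mult)
  have add: "u + w \<in> integer_lattice" if "u \<in> integer_lattice" "w \<in> integer_lattice"
    for u w :: "real ^ 'n"
    using that by (auto simp: integer_lattice_def)
  have diff: "u - w \<in> integer_lattice" if "u \<in> integer_lattice" "w \<in> integer_lattice"
    for u w :: "real ^ 'n"
    using that by (auto simp: integer_lattice_def)
  have "torus_proj (?A *v w) = torus_proj (?A *v v)" if "w \<in> torus_proj v" for w
  proof -
    have d: "?A *v w - ?A *v v \<in> integer_lattice"
      using lat[of "w - v"] that by (simp add: torus_proj_eq matrix_vector_mult_diff_distrib)
    have "x - ?A *v w \<in> integer_lattice \<longleftrightarrow> x - ?A *v v \<in> integer_lattice" for x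
    proof
      assume "x - ?A *v w \<in> integer_lattice"
      from add[OF this d] show "x - ?A *v v \<in> integer_lattice" by simp
    next
      assume "x - ?A *v v \<in> integer_lattice"
      from diff[OF this d] show "x - ?A *v w \<in> integer_lattice" by simp
    qed
    then show ?thesis
      by (simp add: torus_proj_eq)
  qed
  moreover have "v \<in> torus_proj v"
    by (simp add: torus_proj_eq integer_lattice_def)
  ultimately show ?thesis
    unfolding toral_map_def by blast
qed

definition toral_graph :: "int ^ 'n ^ 'n \<Rightarrow> ((real ^ 'n) set \<times> (real ^ 'n) set) set" where
  "toral_graph A = graph_of torus (toral_map A)"

end

theory Submission
  imports Defs "HOL-Algebra.Multiplicative_Group"
begin

text \<open>
  Put \<open>N = card H\<close> and let \<open>H'\<close> be the group of all points of the torus whose order divides \<open>N\<close>.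
  By Lagrange's theorem \<open>H \<subseteq> H'\<close>, and \<open>H'\<close> is finite because it is the image of the lattice
  \<open>N\<^sup>-\<^sup>1 \<int>\<^sup>m\<close>, in which \<open>\<int>\<^sup>m\<close> has index \<open>N\<^sup>m\<close> (lemma \<open>finite_torsion_torus\<close>). The definition of \<open>H'\<close>
  mentions only the group structure, so every automorphism of the torus maps \<open>H'\<close> onto itself
  (\<open>image_torsion\<close>). Hence \<open>A\<close> permutes the cosets of \<open>H'\<close>, the induced map of the quotient is an
  automorphism, and the factor correspondence is its graph (\<open>doubly_invariant_graph\<close>).

  That the correspondences involved are factors of each other rests on two facts about an
  arbitrary compact group. The quotient by a closed normal subgroup is again a compact
  group (\<open>compact_group_quotient\<close>); this follows from the openness of the quotient map, and it is also
  what makes \<open>\<real>\<^sup>m / \<int>\<^sup>m\<close> a Hausdorff topological group. And the image of a correspondence under a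
  continuous surjective homomorphism onto a compact group is a correspondence
  (\<open>is_factor_image\<close>). This is applied to the projections \<open>G \<rightarrow> G/H\<close> and, for \<open>H \<subseteq> K\<close>,
  \<open>G/H \<rightarrow> G/K\<close>.
\<close>

section \<open>Quotients of topological groups\<close>

lemma topspace_quotient_topology:
  assumes "topological_group G T"
  shows "topspace (quotient_topology G T H) = carrier (G Mod H)"
proof -
  interpret topological_group G T by fact
  have "{x \<in> topspace T. H #>\<^bsub>G\<^esub> x \<in> carrier (G Mod H)} = topspace T"
    by (auto simp: topspace_eq carrier_FactGroup)
  then have "openin (quotient_topology G T H) (carrier (G Mod H))"
    by (simp add: openin_quotient_topology)
  moreover have "topspace (quotient_topology G T H) \<subseteq> carrier (G Mod H)"
    using openin_quotient_topology openin_topspace by blast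
  ultimately show ?thesis
    by (meson openin_subset subset_antisym)
qed

lemma quotient_map_coset:
  assumes "topological_group G T"
  shows "quotient_map T (quotient_topology G T H) (\<lambda>x. H #>\<^bsub>G\<^esub> x)"
proof -
  interpret topological_group G T by fact
  show ?thesis
    unfolding quotient_map_def openin_quotient_topology topspace_quotient_topology[OF assms]
    by (auto simp: topspace_eq carrier_FactGroup)
qed

lemma (in topological_group) continuous_map_mult:
  assumes "continuous_map X T f" "continuous_map X T g"
  shows "continuous_map X T (\<lambda>x. f x \<otimes> g x)"
proof -
  have "continuous_map X (prod_topology T T) (\<lambda>x. (f x, g x))"
    using assms by (simp add: continuous_map_paired)
  from continuous_map_compose[OF this continuous_mult] show ?thesis
    by (simp add: o_def)
qed

lemma (in topological_group) continuous_map_translation: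
  assumes "h \<in> carrier G"
  shows "continuous_map T T (\<lambda>x. h \<otimes> x)"
  using assms by (intro continuous_map_mult) (auto simp: topspace_eq)

text \<open>The preimage of the image of an open set \<open>U\<close> is the union of the translates of \<open>U\<close> by
  elements of \<open>H\<close>.\<close>

lemma open_map_coset:
  assumes "topological_group G T" "subgroup H G"
  shows "open_map T (quotient_topology G T H) (\<lambda>x. H #>\<^bsub>G\<^esub> x)"
  unfolding open_map_def openin_quotient_topology
proof (intro allI impI conjI)
  interpret topological_group G T by fact
  interpret subgroup H G by fact
  fix U assume U: "openin T U"
  then have Uc: "U \<subseteq> carrier G"
    using openin_subset topspace_eq by fastforce
  then show "(#>\<^bsub>G\<^esub>) H ` U \<subseteq> carrier (G Mod H)"
    by (auto simp: carrier_FactGroup)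
  have "H #>\<^bsub>G\<^esub> x \<in> (#>\<^bsub>G\<^esub>) H ` U \<longleftrightarrow> (\<exists>h\<in>H. h \<otimes>\<^bsub>G\<^esub> x \<in> U)" if x: "x \<in> carrier G" for x
  proof
    assume "H #>\<^bsub>G\<^esub> x \<in> (#>\<^bsub>G\<^esub>) H ` U"
    then obtain u where eq: "H #>\<^bsub>G\<^esub> x = H #>\<^bsub>G\<^esub> u" and u: "u \<in> U"
      by auto
    have "u \<in> H #>\<^bsub>G\<^esub> x"
      using u Uc eq rcos_self[OF _ assms(2)] by auto
    then show "\<exists>h\<in>H. h \<otimes>\<^bsub>G\<^esub> x \<in> U"
      using u by (auto simp: r_coset_def)
  next
    assume "\<exists>h\<in>H. h \<otimes>\<^bsub>G\<^esub> x \<in> U"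
    then obtain h where h: "h \<in> H" and u: "h \<otimes>\<^bsub>G\<^esub> x \<in> U"
      by auto
    have "h \<otimes>\<^bsub>G\<^esub> x \<in> H #>\<^bsub>G\<^esub> x"
      using h by (auto simp: r_coset_def)
    then have "H #>\<^bsub>G\<^esub> x = H #>\<^bsub>G\<^esub> (h \<otimes>\<^bsub>G\<^esub> x)"
      using x assms(2) repr_independence by blast
    then show "H #>\<^bsub>G\<^esub> x \<in> (#>\<^bsub>G\<^esub>) H ` U"
      using u by auto
  qed
  then have "{x \<in> topspace T. H #>\<^bsub>G\<^esub> x \<in> (#>\<^bsub>G\<^esub>) H ` U} =
      (\<Union>h\<in>H. {x \<in> topspace T. h \<otimes>\<^bsub>G\<^esub> x \<in> U})"
    unfolding topspace_eq by blast
  moreover have "openin T {x \<in> topspace T. h \<otimes>\<^bsub>G\<^esub> x \<in> U}" if "h \<in> H" for h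
    using openin_continuous_map_preimage[OF continuous_map_translation U] that mem_carrier by simp
  ultimately show "openin T {x \<in> topspace T. H #>\<^bsub>G\<^esub> x \<in> (#>\<^bsub>G\<^esub>) H ` U}"
    by auto
qed

lemma open_map_map_prod:
  assumes "open_map X X' f" "open_map Y Y' g"
  shows "open_map (prod_topology X Y) (prod_topology X' Y') (map_prod f g)"
  unfolding open_map_def
proof (intro allI impI)
  fix W assume W: "openin (prod_topology X Y) W"
  show "openin (prod_topology X' Y') (map_prod f g ` W)"
    unfolding openin_prod_topology_alt
  proof (intro allI impI)
    fix a b assume "(a, b) \<in> map_prod f g ` W"
    then obtain x y where xy: "(x, y) \<in> W" "a = f x" "b = g y"
      by auto
    then obtain U V where UV: "openin X U" "openin Y V" "x \<in> U" "y \<in> V" "U \<times> V \<subseteq> W"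
      using W unfolding openin_prod_topology_alt by metis
    have "f ` U \<times> g ` V \<subseteq> map_prod f g ` W"
      using UV(5) by fastforce
    with UV xy assms show "\<exists>U V. openin X' U \<and> openin Y' V \<and> a \<in> U \<and> b \<in> V \<and>
        U \<times> V \<subseteq> map_prod f g ` W"
      unfolding open_map_def by blast
  qed
qed

lemma continuous_map_map_prod:
  assumes "continuous_map X X' f" "continuous_map Y Y' g"
  shows "continuous_map (prod_topology X Y) (prod_topology X' Y') (map_prod f g)"
  using assms by (simp add: map_prod_def continuous_map_prod_top)

text \<open>A product of quotient maps need not be a quotient map, but a product of open surjections is
  one. This is what lets continuity of the multiplication descend to the quotient.\<close>

lemma quotient_map_coset_prod:
  assumes "topological_group G T" "subgroup H G"
  shows "quotient_map (prod_topology T T)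
    (prod_topology (quotient_topology G T H) (quotient_topology G T H))
    (map_prod (\<lambda>x. H #>\<^bsub>G\<^esub> x) (\<lambda>x. H #>\<^bsub>G\<^esub> x))"
proof (rule continuous_open_imp_quotient_map)
  note q = quotient_map_coset[OF assms(1), of H]
  show "continuous_map (prod_topology T T)
    (prod_topology (quotient_topology G T H) (quotient_topology G T H))
    (map_prod (\<lambda>x. H #>\<^bsub>G\<^esub> x) (\<lambda>x. H #>\<^bsub>G\<^esub> x))"
    by (intro continuous_map_map_prod quotient_imp_continuous_map q)
  show "open_map (prod_topology T T)
    (prod_topology (quotient_topology G T H) (quotient_topology G T H))
    (map_prod (\<lambda>x. H #>\<^bsub>G\<^esub> x) (\<lambda>x. H #>\<^bsub>G\<^esub> x))"
    by (intro open_map_map_prod open_map_coset assms)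
  show "map_prod (\<lambda>x. H #>\<^bsub>G\<^esub> x) (\<lambda>x. H #>\<^bsub>G\<^esub> x) ` topspace (prod_topology T T) =
    topspace (prod_topology (quotient_topology G T H) (quotient_topology G T H))"
    using quotient_imp_surjective_map[OF q] by (simp add: map_prod_surj_on)
qed

lemma topological_group_quotient:
  assumes "topological_group G T" "H \<lhd> G"
  shows "topological_group (G Mod H) (quotient_topology G T H)"
proof -
  interpret topological_group G T by fact
  interpret normal H G by fact
  let ?Q = "quotient_topology G T H"
  have q: "quotient_map T ?Q (\<lambda>x. H #>\<^bsub>G\<^esub> x)"
    by (rule quotient_map_coset) fact
  have qc: "continuous_map T ?Q (\<lambda>x. H #>\<^bsub>G\<^esub> x)"
    by (rule quotient_imp_continuous_map) fact
  have 1: "continuous_map (prod_topology T T) ?Q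
      ((\<lambda>(X, Y). X \<otimes>\<^bsub>G Mod H\<^esub> Y) \<circ> map_prod (\<lambda>x. H #>\<^bsub>G\<^esub> x) (\<lambda>x. H #>\<^bsub>G\<^esub> x))"
    by (rule continuous_map_eq[OF continuous_map_compose[OF continuous_mult qc]])
      (auto simp: topspace_eq rcos_sum)
  have 2: "continuous_map T ?Q ((\<lambda>X. inv\<^bsub>G Mod H\<^esub> X) \<circ> (\<lambda>x. H #>\<^bsub>G\<^esub> x))"
    by (rule continuous_map_eq[OF continuous_map_compose[OF continuous_inv qc]])
      (auto simp: topspace_eq inv_FactGroup rcos_inv carrier_FactGroup)
  show ?thesis
  proof (intro topological_group.intro topological_group_axioms.intro)
    show "group (G Mod H)" by (rule factorgroup_is_group)
    show "topspace ?Q = carrier (G Mod H)"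
      by (rule topspace_quotient_topology) fact
    show "continuous_map (prod_topology ?Q ?Q) ?Q (\<lambda>(X, Y). X \<otimes>\<^bsub>G Mod H\<^esub> Y)"
      using quotient_map_coset_prod[OF assms(1) is_subgroup] 1
      by (rule continuous_compose_quotient_map)
    show "continuous_map ?Q ?Q (\<lambda>X. inv\<^bsub>G Mod H\<^esub> X)"
      using q 2 by (rule continuous_compose_quotient_map)
  qed
qed

lemma rcos_eq_iff:
  assumes "group G" "subgroup H G" "x \<in> carrier G" "y \<in> carrier G"
  shows "H #>\<^bsub>G\<^esub> x = H #>\<^bsub>G\<^esub> y \<longleftrightarrow> x \<otimes>\<^bsub>G\<^esub> inv\<^bsub>G\<^esub> y \<in> H"
proof -
  interpret group G by fact
  interpret H: subgroup H G by fact
  have "H #>\<^bsub>G\<^esub> x = H #>\<^bsub>G\<^esub> y \<longleftrightarrow> x \<in> H #>\<^bsub>G\<^esub> y"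
    using assms repr_independence[of x H y] rcos_self[of x H] by auto
  also have "\<dots> \<longleftrightarrow> x \<otimes>\<^bsub>G\<^esub> inv\<^bsub>G\<^esub> y \<in> H"
    using assms by (auto simp: r_coset_def m_assoc inv_solve_right intro!: bexI[of _ "x \<otimes>\<^bsub>G\<^esub> inv\<^bsub>G\<^esub> y"])
  finally show ?thesis .
qed

text \<open>The diagonal of \<open>G/H\<close> pulls back to \<open>{(x, y). x y\<^sup>-\<^sup>1 \<in> H}\<close>, which is closed when \<open>H\<close> is.\<close>

lemma Hausdorff_space_quotient:
  assumes "topological_group G T" "H \<lhd> G" "closedin T H"
  shows "Hausdorff_space (quotient_topology G T H)"
proof -
  interpret topological_group G T by fact
  interpret normal H G by fact
  let ?Q = "quotient_topology G T H"
  let ?q = "\<lambda>x. H #>\<^bsub>G\<^esub> x"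
  let ?D = "(\<lambda>X. (X, X)) ` topspace ?Q"
  have top: "topspace ?Q = ?q ` carrier G"
    using topspace_quotient_topology[OF assms(1), of H] by (simp add: carrier_FactGroup)
  have "continuous_map (prod_topology T T) T (\<lambda>p. fst p \<otimes>\<^bsub>G\<^esub> inv\<^bsub>G\<^esub> (snd p))"
    using continuous_map_compose[OF continuous_map_snd continuous_inv, of T]
    by (intro continuous_map_mult) (auto simp: o_def continuous_map_fst)
  then have "closedin (prod_topology T T)
      {p \<in> topspace (prod_topology T T). fst p \<otimes>\<^bsub>G\<^esub> inv\<^bsub>G\<^esub> (snd p) \<in> H}"
    using assms(3) by (rule closedin_continuous_map_preimage)
  also have "{p \<in> topspace (prod_topology T T). fst p \<otimes>\<^bsub>G\<^esub> inv\<^bsub>G\<^esub> (snd p) \<in> H} =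
      {p \<in> topspace (prod_topology T T). map_prod ?q ?q p \<in> ?D}"
    by (auto simp: topspace_eq top simp flip: rcos_eq_iff[OF is_group is_subgroup])
  finally have "closedin (prod_topology T T)
      {p \<in> topspace (prod_topology T T). map_prod ?q ?q p \<in> ?D}" .
  moreover have "?D \<subseteq> topspace (prod_topology ?Q ?Q)"
    by auto
  ultimately have "closedin (prod_topology ?Q ?Q) ?D"
    using quotient_map_coset_prod[OF assms(1) is_subgroup] unfolding quotient_map_closedin by blast
  then show ?thesis
    unfolding Hausdorff_space_closedin_diagonal .
qed

lemma compact_group_quotient:
  assumes "compact_group G T" "H \<lhd> G" "closedin T H"
  shows "compact_group (G Mod H) (quotient_topology G T H)"
proof -
  interpret compact_group G T by fact
  have tg: "topological_group G T" by unfold_locales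
  show ?thesis
  proof (intro compact_group.intro compact_group_axioms.intro)
    show "topological_group (G Mod H) (quotient_topology G T H)"
      using tg assms(2) by (rule topological_group_quotient)
    show "Hausdorff_space (quotient_topology G T H)"
      using tg assms(2,3) by (rule Hausdorff_space_quotient)
    show "compact_space (quotient_topology G T H)"
      using compact quotient_map_coset[OF tg, of H]
      by (metis compact_space_def image_compactin quotient_imp_continuous_map
          quotient_imp_surjective_map)
  qed
qed


section \<open>Factors of correspondences\<close>

lemma compact_group_is_group: "compact_group G T \<Longrightarrow> group G"
  by (simp add: compact_group_def topological_group_def)

text \<open>The only property of the image that is not algebraic is that it is closed: it is a compact
  subset of a Hausdorff space.\<close>

lemma is_factor_image:
  assumes P: "correspondence G T P" and G': "compact_group G' T'"
    and hom: "\<phi> \<in> hom G G'" and cont: "continuous_map T T' \<phi>"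
    and surj: "\<phi> ` carrier G = carrier G'"
  shows "is_factor G' T' (map_prod \<phi> \<phi> ` P) G T P"
proof -
  have cG: "compact_group G T" and sub: "subgroup P (G \<times>\<times> G)"
    and clo: "closedin (prod_topology T T) P"
    and fst: "fst ` P = carrier G" and snd: "snd ` P = carrier G"
    using P by (auto simp: correspondence_def)
  note groups = compact_group_is_group[OF cG] compact_group_is_group[OF G']
  have "map_prod \<phi> \<phi> \<in> hom (G \<times>\<times> G) (G' \<times>\<times> G')"
    using hom by (auto simp: hom_def DirProd_def)
  then interpret group_hom "G \<times>\<times> G" "G' \<times>\<times> G'" "map_prod \<phi> \<phi>"
    using groups by (simp add: group_hom_def group_hom_axioms_def DirProd_group)
  have "subgroup (map_prod \<phi> \<phi> ` P) (G' \<times>\<times> G')"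
    by (rule subgroup_img_is_subgroup) fact
  moreover have "closedin (prod_topology T' T') (map_prod \<phi> \<phi> ` P)"
  proof (rule compactin_imp_closedin)
    show "Hausdorff_space (prod_topology T' T')"
      using G' by (simp add: Hausdorff_space_prod_topology compact_group_def compact_group_axioms_def)
    have "compact_space (prod_topology T T)"
      using cG by (simp add: compact_space_prod_topology compact_group_def compact_group_axioms_def)
    then have "compactin (prod_topology T T) P"
      using clo by (rule closedin_compact_space)
    then show "compactin (prod_topology T' T') (map_prod \<phi> \<phi> ` P)"
      by (rule image_compactin) (intro continuous_map_map_prod cont)
  qed
  moreover have "fst ` map_prod \<phi> \<phi> ` P = carrier G'" "snd ` map_prod \<phi> \<phi> ` P = carrier G'"
    using surj fst snd image_comp[of \<phi> fst P] image_comp[of \<phi> snd P]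
    by (simp_all add: image_image o_def)
  ultimately have "correspondence G' T' (map_prod \<phi> \<phi> ` P)"
    using G' by (simp add: correspondence_def)
  then show ?thesis
    using assms by (auto simp: is_factor_def)
qed

lemma is_factor_quotient:
  assumes "correspondence G T P" "H \<lhd> G" "closedin T H"
  shows "is_factor (G Mod H) (quotient_topology G T H) (factor_correspondence G P H) G T P"
  unfolding factor_correspondence_def
proof (rule is_factor_image[OF assms(1)])
  have cG: "compact_group G T"
    using assms(1) by (simp add: correspondence_def)
  then have tg: "topological_group G T"
    by (simp add: compact_group_def)
  show "compact_group (G Mod H) (quotient_topology G T H)"
    using cG assms(2,3) by (rule compact_group_quotient)
  show "(#>\<^bsub>G\<^esub>) H \<in> hom G (G Mod H)"
    using normal.r_coset_hom_Mod[OF assms(2)] by simp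
  show "continuous_map T (quotient_topology G T H) ((#>\<^bsub>G\<^esub>) H)"
    using quotient_map_coset[OF tg] by (rule quotient_imp_continuous_map)
  show "(#>\<^bsub>G\<^esub>) H ` carrier G = carrier (G Mod H)"
    by (simp add: carrier_FactGroup)
qed

text \<open>The projection \<open>G/H \<rightarrow> G/K\<close> sends a coset \<open>X\<close> of \<open>H\<close> to the product set \<open>K X\<close>.\<close>

lemma set_mult_coset:
  assumes "group G" "subgroup H G" "subgroup K G" "H \<subseteq> K" "x \<in> carrier G"
  shows "K <#>\<^bsub>G\<^esub> (H #>\<^bsub>G\<^esub> x) = K #>\<^bsub>G\<^esub> x"
proof -
  interpret group G by fact
  interpret H: subgroup H G by fact
  interpret K: subgroup K G by fact
  have "K <#>\<^bsub>G\<^esub> (H #>\<^bsub>G\<^esub> x) = (K <#>\<^bsub>G\<^esub> H) #>\<^bsub>G\<^esub> x"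
    using assms(5) H.subset K.subset by (simp add: setmult_rcos_assoc)
  also have "K <#>\<^bsub>G\<^esub> H = K"
    using assms(4) by (force simp: set_mult_def intro!: bexI[of _ "\<one>\<^bsub>G\<^esub>"])
  finally show ?thesis .
qed

lemma is_factor_quotient_quotient:
  assumes P: "correspondence G T P" and H: "H \<lhd> G" "closedin T H"
    and K: "K \<lhd> G" "closedin T K" and "H \<subseteq> K"
  shows "is_factor (G Mod K) (quotient_topology G T K) (factor_correspondence G P K)
    (G Mod H) (quotient_topology G T H) (factor_correspondence G P H)"
proof -
  let ?\<phi> = "\<lambda>X. K <#>\<^bsub>G\<^esub> X"
  have cG: "compact_group G T" and PG: "P \<subseteq> carrier G \<times> carrier G"
    using P by (auto simp: correspondence_def DirProd_def dest!: subgroup.subset)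
  then have tg: "topological_group G T"
    by (simp add: compact_group_def)
  interpret topological_group G T by fact
  interpret H: normal H G by fact
  interpret K: normal K G by fact
  have \<phi>: "?\<phi> (H #>\<^bsub>G\<^esub> x) = K #>\<^bsub>G\<^esub> x" if "x \<in> carrier G" for x
    using that \<open>H \<subseteq> K\<close> by (intro set_mult_coset is_group H.is_subgroup K.is_subgroup)
  have "is_factor (G Mod K) (quotient_topology G T K) (map_prod ?\<phi> ?\<phi> ` factor_correspondence G P H)
    (G Mod H) (quotient_topology G T H) (factor_correspondence G P H)"
  proof (rule is_factor_image)
    show "correspondence (G Mod H) (quotient_topology G T H) (factor_correspondence G P H)"
      using is_factor_quotient[OF P H] by (simp add: is_factor_def)
    show "compact_group (G Mod K) (quotient_topology G T K)"
      using cG K by (rule compact_group_quotient)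
    show "?\<phi> \<in> hom (G Mod H) (G Mod K)"
      by (rule homI) (auto simp: carrier_FactGroup \<phi> H.rcos_sum K.rcos_sum)
    show "?\<phi> ` carrier (G Mod H) = carrier (G Mod K)"
      by (auto simp: carrier_FactGroup image_image \<phi>)
    have "continuous_map T (quotient_topology G T K) (?\<phi> \<circ> (\<lambda>x. H #>\<^bsub>G\<^esub> x))"
      by (rule continuous_map_eq[OF quotient_imp_continuous_map[OF quotient_map_coset[OF tg]]])
        (auto simp: topspace_eq \<phi>)
    then show "continuous_map (quotient_topology G T H) (quotient_topology G T K) ?\<phi>"
      by (rule continuous_compose_quotient_map[OF quotient_map_coset[OF tg]])
  qed
  also have "map_prod ?\<phi> ?\<phi> ` factor_correspondence G P H = factor_correspondence G P K"
    unfolding factor_correspondence_def image_image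
    using PG by (intro image_cong) (auto simp: \<phi>)
  finally show ?thesis .
qed


section \<open>Graphs of automorphisms\<close>

text \<open>The fibre over the identity on either side is trivial: on one side because \<open>f\<close> is
  single-valued, on the other because it is injective.\<close>

lemma graph_in_finite_to_one_correspondences:
  assumes cG: "compact_group G T" and f: "topological_automorphism G T f"
  shows "graph_of G f \<in> finite_to_one_correspondences G T"
proof -
  interpret compact_group G T by fact
  have hom: "f \<in> hom G G" and bij: "bij_betw f (carrier G) (carrier G)"
    and cont: "continuous_map T T f"
    using f by (auto simp: topological_automorphism_def iso_def)
  interpret f: group_hom G G f
    using hom by unfold_locales
  have img: "graph_of G f = (\<lambda>x. (x, f x)) ` carrier G"
    by (auto simp: graph_of_def)
  have "(\<lambda>x. (x, f x)) \<in> hom G (G \<times>\<times> G)"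
    by (rule homI) (auto simp: DirProd_def)
  then interpret g: group_hom G "G \<times>\<times> G" "\<lambda>x. (x, f x)"
    by (simp add: group_hom_def group_hom_axioms_def DirProd_group is_group)
  have "subgroup (graph_of G f) (G \<times>\<times> G)"
    unfolding img by (rule g.img_is_subgroup)
  moreover have "closedin (prod_topology T T) (graph_of G f)"
    using continuous_map_imp_closed_graph[OF cont Hausdorff] by (simp add: img topspace_eq)
  moreover have "fst ` graph_of G f = carrier G" "snd ` graph_of G f = carrier G"
    using bij by (auto simp: img image_image bij_betw_def)
  moreover have "{x. (x, \<one>\<^bsub>G\<^esub>) \<in> graph_of G f} \<subseteq> {\<one>\<^bsub>G\<^esub>}"
    using bij inj_onD[of f "carrier G" _ "\<one>\<^bsub>G\<^esub>"] by (fastforce simp: img bij_betw_def)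
  moreover have "{y. (\<one>\<^bsub>G\<^esub>, y) \<in> graph_of G f} \<subseteq> {\<one>\<^bsub>G\<^esub>}"
    by (auto simp: img)
  ultimately show ?thesis
    using cG by (simp add: finite_to_one_correspondences_def correspondence_def finite_subset)
qed

lemma image_r_coset:
  assumes "f \<in> hom G G" "H \<subseteq> carrier G" "x \<in> carrier G"
  shows "f ` (H #>\<^bsub>G\<^esub> x) = (f ` H) #>\<^bsub>G\<^esub> f x"
proof -
  have "f (h \<otimes>\<^bsub>G\<^esub> x) = f h \<otimes>\<^bsub>G\<^esub> f x" if "h \<in> H" for h
    using assms that by (auto intro: hom_mult)
  moreover have "K #>\<^bsub>G\<^esub> y = (\<lambda>h. h \<otimes>\<^bsub>G\<^esub> y) ` K" for K y
    by (auto simp: r_coset_def)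
  ultimately show ?thesis
    by (simp add: image_image cong: image_cong)
qed

text \<open>Since \<open>f ` (H x) = (f ` H) (f x)\<close>, direct image under \<open>f\<close> takes cosets of \<open>H\<close> to cosets of
  \<open>f ` H\<close>. As \<open>f ` H = H\<close>, it is a map of \<open>G/H\<close> to itself, and it inherits bijectivity from
  \<open>f\<close>.\<close>

lemma doubly_invariant_graph:
  assumes tg: "topological_group G T" and f: "topological_automorphism G T f"
    and H: "H \<lhd> G" "closedin T H" and inv: "f ` H = H"
  shows "doubly_invariant G T (graph_of G f) H"
proof -
  interpret topological_group G T by fact
  interpret normal H G by fact
  have hom: "f \<in> hom G G" and bij: "bij_betw f (carrier G) (carrier G)"
    and cont: "continuous_map T T f"
    using f by (auto simp: topological_automorphism_def iso_def)
  have fc: "f x \<in> carrier G" if "x \<in> carrier G" for x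
    using hom that by (auto simp: hom_def)
  let ?B = "\<lambda>X. f ` X"
  have B: "?B (H #>\<^bsub>G\<^esub> x) = H #>\<^bsub>G\<^esub> f x" if "x \<in> carrier G" for x
    using image_r_coset[OF hom subset that] inv by simp
  have fm: "f (x \<otimes>\<^bsub>G\<^esub> y) = f x \<otimes>\<^bsub>G\<^esub> f y" if "x \<in> carrier G" "y \<in> carrier G" for x y
    using hom that by (simp add: hom_mult)
  have "?B \<in> hom (G Mod H) (G Mod H)"
  proof (rule homI)
    fix X assume "X \<in> carrier (G Mod H)"
    then obtain x where x: "x \<in> carrier G" "X = H #>\<^bsub>G\<^esub> x"
      by (auto simp: carrier_FactGroup)
    then show "?B X \<in> carrier (G Mod H)"
      using B fc by (simp add: carrier_FactGroup)
    fix Y assume "Y \<in> carrier (G Mod H)"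
    then obtain y where y: "y \<in> carrier G" "Y = H #>\<^bsub>G\<^esub> y"
      by (auto simp: carrier_FactGroup)
    show "?B (X \<otimes>\<^bsub>G Mod H\<^esub> Y) = ?B X \<otimes>\<^bsub>G Mod H\<^esub> ?B Y"
      using x y by (simp add: B fc rcos_sum fm)
  qed
  moreover have "bij_betw ?B (carrier (G Mod H)) (carrier (G Mod H))"
    unfolding bij_betw_def
  proof
    have sub: "X \<subseteq> carrier G" if "X \<in> carrier (G Mod H)" for X
      using that r_coset_subset_G[OF subset] by (auto simp: carrier_FactGroup)
    show "inj_on ?B (carrier (G Mod H))"
    proof (rule inj_onI)
      fix X Y assume "X \<in> carrier (G Mod H)" "Y \<in> carrier (G Mod H)" "?B X = ?B Y"
      then show "X = Y"
        using inj_on_image_eq_iff[OF bij_betw_imp_inj_on[OF bij] sub sub] by simp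
    qed
    have "?B ` carrier (G Mod H) = (\<lambda>x. H #>\<^bsub>G\<^esub> x) ` f ` carrier G"
      unfolding carrier_FactGroup image_image by (intro image_cong refl B)
    then show "?B ` carrier (G Mod H) = carrier (G Mod H)"
      using bij by (simp add: carrier_FactGroup bij_betw_def)
  qed
  moreover have "continuous_map (quotient_topology G T H) (quotient_topology G T H) ?B"
  proof (rule continuous_compose_quotient_map[OF quotient_map_coset[OF tg]])
    have "continuous_map T (quotient_topology G T H) ((\<lambda>x. H #>\<^bsub>G\<^esub> x) \<circ> f)"
      using cont quotient_imp_continuous_map[OF quotient_map_coset[OF tg]]
      by (rule continuous_map_compose)
    then show "continuous_map T (quotient_topology G T H) (?B \<circ> (\<lambda>x. H #>\<^bsub>G\<^esub> x))"
      by (rule continuous_map_eq) (auto simp: topspace_eq B)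
  qed
  moreover have "factor_correspondence G (graph_of G f) H = graph_of (G Mod H) ?B"
  proof -
    have "factor_correspondence G (graph_of G f) H =
        (\<lambda>x. (H #>\<^bsub>G\<^esub> x, H #>\<^bsub>G\<^esub> f x)) ` carrier G"
      by (force simp: factor_correspondence_def graph_of_def)
    also have "\<dots> = (\<lambda>x. (H #>\<^bsub>G\<^esub> x, ?B (H #>\<^bsub>G\<^esub> x))) ` carrier G"
      using B by (intro image_cong refl) simp
    also have "\<dots> = graph_of (G Mod H) ?B"
      unfolding graph_of_def carrier_FactGroup by blast
    finally show ?thesis .
  qed
  ultimately show ?thesis
    using H by (auto simp: doubly_invariant_def topological_automorphism_def iso_def)
qed


section \<open>Torsion subgroups\<close>

definition torsion :: "('a, 'b) monoid_scheme \<Rightarrow> nat \<Rightarrow> 'a set" where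
  "torsion G n = {x \<in> carrier G. x [^]\<^bsub>G\<^esub> n = \<one>\<^bsub>G\<^esub>}"

lemma (in comm_group) subgroup_torsion: "subgroup (torsion G n) G"
  by unfold_locales (auto simp: torsion_def nat_pow_distrib nat_pow_inv)

text \<open>By Lagrange's theorem in \<open>H\<close>, the order of an element of \<open>H\<close> divides \<open>card H\<close>.\<close>

lemma (in group) subgroup_subset_torsion:
  assumes "subgroup H G" "finite H"
  shows "H \<subseteq> torsion G (card H)"
proof
  fix x assume x: "x \<in> H"
  interpret H: subgroup H G by fact
  interpret GH: group "G\<lparr>carrier := H\<rparr>"
    using assms(1) by (rule subgroup_imp_group)
  have "x [^]\<^bsub>G\<lparr>carrier := H\<rparr>\<^esub> order (G\<lparr>carrier := H\<rparr>) = \<one>\<^bsub>G\<lparr>carrier := H\<rparr>\<^esub>"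
    using x by (intro GH.pow_order_eq_1) simp
  then show "x \<in> torsion G (card H)"
    using x by (simp add: torsion_def order_def nat_pow_def)
qed

text \<open>For an automorphism \<open>f\<close>, a point \<open>x\<close> is \<open>n\<close>-torsion if and only if \<open>f x\<close> is, and every
  torsion point is a value of \<open>f\<close>.\<close>

lemma image_torsion:
  assumes "group G" "f \<in> iso G G"
  shows "f ` torsion G n = torsion G n"
proof -
  interpret group G by fact
  have bij: "bij_betw f (carrier G) (carrier G)" and hom: "f \<in> hom G G"
    using assms(2) by (auto simp: iso_def)
  interpret f: group_hom G G f
    using hom by unfold_locales
  have "f x [^]\<^bsub>G\<^esub> n = \<one>\<^bsub>G\<^esub> \<longleftrightarrow> x [^]\<^bsub>G\<^esub> n = \<one>\<^bsub>G\<^esub>" if "x \<in> carrier G" for x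
  proof -
    have "f x [^]\<^bsub>G\<^esub> n = \<one>\<^bsub>G\<^esub> \<longleftrightarrow> f (x [^]\<^bsub>G\<^esub> n) = f \<one>\<^bsub>G\<^esub>"
      using that by (simp add: f.hom_nat_pow)
    also have "\<dots> \<longleftrightarrow> x [^]\<^bsub>G\<^esub> n = \<one>\<^bsub>G\<^esub>"
      using bij that by (intro inj_on_eq_iff) (auto simp: bij_betw_def)
    finally show ?thesis .
  qed
  then have "torsion G n = {x \<in> carrier G. f x \<in> torsion G n}"
    by (auto simp: torsion_def)
  moreover have "torsion G n \<subseteq> f ` carrier G"
    using bij by (auto simp: torsion_def bij_betw_def)
  ultimately show ?thesis
    by blast
qed


section \<open>The torus\<close>

lemma closed_integer_lattice: "closed (integer_lattice :: (real ^ 'n) set)"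
proof -
  have "integer_lattice = (\<Inter>i. (\<lambda>v :: real ^ 'n. v $ i) -` \<int>)"
    by (auto simp: integer_lattice_def)
  also have "closed \<dots>"
    by (intro closed_INT ballI closed_vimage closed_Ints continuous_intros)
  finally show ?thesis .
qed

lemma comm_group_vector_group: "comm_group (vector_group :: (real ^ 'n) monoid)"
proof (rule comm_groupI)
  show "\<exists>y\<in>carrier vector_group. y \<otimes>\<^bsub>vector_group\<^esub> x = \<one>\<^bsub>vector_group\<^esub>"
    if "x \<in> carrier vector_group" for x :: "real ^ 'n"
    by (rule bexI[of _ "- x"]) (simp_all add: vector_group_def)
qed (auto simp: vector_group_def)

lemma inv_vector_group: "inv\<^bsub>vector_group\<^esub> v = - v" for v :: "real ^ 'n"
  using comm_group.axioms(2)[OF comm_group_vector_group]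
  by (intro group.inv_equality) (auto simp: vector_group_def)

lemma topological_group_vector_group:
  "topological_group (vector_group :: (real ^ 'n) monoid) euclidean"
proof (intro topological_group.intro topological_group_axioms.intro)
  show "group (vector_group :: (real ^ 'n) monoid)"
    using comm_group_vector_group by (rule comm_group.axioms)
  show "topspace euclidean = carrier (vector_group :: (real ^ 'n) monoid)"
    by (simp add: vector_group_def)
  have "continuous_on UNIV (\<lambda>p :: (real ^ 'n) \<times> (real ^ 'n). fst p + snd p)"
    by (intro continuous_intros)
  then show "continuous_map (prod_topology euclidean euclidean) euclidean
      (\<lambda>(x :: real ^ 'n, y). x \<otimes>\<^bsub>vector_group\<^esub> y)"
    by (simp add: vector_group_def case_prod_unfold)
  show "continuous_map euclidean euclidean (\<lambda>x :: real ^ 'n. inv\<^bsub>vector_group\<^esub> x)"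
    unfolding inv_vector_group by (simp add: continuous_on_minus)
qed

lemma normal_integer_lattice: "(integer_lattice :: (real ^ 'n) set) \<lhd> vector_group"
proof (rule comm_group.normal_iff_subgroup[OF comm_group_vector_group, THEN iffD2])
  have "group (vector_group :: (real ^ 'n) monoid)"
    using comm_group_vector_group by (rule comm_group.axioms)
  then show "subgroup (integer_lattice :: (real ^ 'n) set) vector_group"
    by (rule group.subgroupI)
      (auto simp: vector_group_def inv_vector_group[unfolded vector_group_def] integer_lattice_def
        intro!: exI[of _ 0])
qed

lemma comm_group_torus: "comm_group (torus :: (real ^ 'n) set monoid)"
  unfolding torus_def
  using comm_group.abelian_FactGroup[OF comm_group_vector_group]
    normal_imp_subgroup[OF normal_integer_lattice] by blast

lemma topspace_torus_topology: "topspace torus_topology = carrier torus"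
  unfolding torus_topology_def torus_def
  by (rule topspace_quotient_topology[OF topological_group_vector_group])

lemma quotient_map_torus_proj: "quotient_map euclidean torus_topology torus_proj"
  unfolding torus_topology_def torus_proj_def
  by (rule quotient_map_coset[OF topological_group_vector_group])

lemma torus_proj_eq_iff: "torus_proj v = torus_proj w \<longleftrightarrow> v - w \<in> integer_lattice"
  using rcos_eq_iff[OF comm_group.axioms(2)[OF comm_group_vector_group]
      normal_imp_subgroup[OF normal_integer_lattice], of v w]
  by (simp add: torus_proj_def inv_vector_group) (simp add: vector_group_def)

lemma mult_torus: "torus_proj v \<otimes>\<^bsub>torus\<^esub> torus_proj w = torus_proj (v + w)"
  unfolding torus_proj_def torus_def
  using normal.rcos_sum[OF normal_integer_lattice, of v w] by (simp add: vector_group_def)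

lemma one_torus: "\<one>\<^bsub>torus\<^esub> = torus_proj 0"
  by (simp add: torus_def torus_proj_eq)

lemma pow_torus: "torus_proj v [^]\<^bsub>torus\<^esub> n = torus_proj (real n *\<^sub>R v)" for n :: nat
proof (induction n)
  case 0
  show ?case by (simp add: one_torus nat_pow_def)
next
  case (Suc n)
  interpret comm_group torus by (rule comm_group_torus)
  show ?case
    using Suc by (simp add: mult_torus algebra_simps)
qed

text \<open>Replace each coordinate of a representative by its fractional part.\<close>

lemma torus_proj_unit_cube:
  "\<exists>w. torus_proj v = torus_proj w \<and> (\<forall>i. 0 \<le> w $ i \<and> w $ i < 1)"
  by (rule exI[of _ "\<chi> i. frac (v $ i)"])
    (auto simp: torus_proj_eq_iff integer_lattice_def frac_def frac_lt_1[unfolded frac_def])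

lemma compact_group_torus:
  "compact_group (torus :: (real ^ 'n) set monoid) torus_topology"
proof (intro compact_group.intro compact_group_axioms.intro)
  show "topological_group (torus :: (real ^ 'n) set monoid) torus_topology"
    unfolding torus_def torus_topology_def
    by (intro topological_group_quotient topological_group_vector_group normal_integer_lattice)
  show "Hausdorff_space (torus_topology :: (real ^ 'n) set topology)"
    unfolding torus_topology_def
    by (intro Hausdorff_space_quotient topological_group_vector_group normal_integer_lattice)
      (simp add: closed_integer_lattice)
  have "compactin torus_topology (torus_proj ` (cbox 0 1 :: (real ^ 'n) set))"
    by (rule image_compactin[OF _ quotient_imp_continuous_map[OF quotient_map_torus_proj]]) simp
  also have "torus_proj ` (cbox 0 1 :: (real ^ 'n) set) = carrier torus"
  proof
    show "carrier torus \<subseteq> torus_proj ` (cbox 0 1 :: (real ^ 'n) set)"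
    proof
      fix X :: "(real ^ 'n) set" assume "X \<in> carrier torus"
      then obtain v where "X = torus_proj v"
        by (auto simp: carrier_torus)
      then obtain w where "X = torus_proj w" "\<forall>i. 0 \<le> w $ i \<and> w $ i < 1"
        using torus_proj_unit_cube by metis
      then show "X \<in> torus_proj ` cbox 0 1"
        by (auto simp: mem_box_cart less_imp_le)
    qed
  qed (auto simp: carrier_torus)
  finally show "compact_space (torus_topology :: (real ^ 'n) set topology)"
    by (simp add: compact_space_def topspace_torus_topology)
qed

text \<open>Coordinates of an \<open>n\<close>-torsion point in the unit cube are fractions \<open>k / n\<close> with
  \<open>0 \<le> k < n\<close>, so there are at most \<open>n\<close> to the dimension such points.\<close>

lemma finite_torsion_torus:
  assumes "n > 0"
  shows "finite (torsion (torus :: (real ^ 'n) set monoid) n)"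
proof (rule finite_subset)
  let ?S = "(\<lambda>k. torus_proj (\<chi> i :: 'n. real_of_int (k i) / real n)) ` (UNIV \<rightarrow>\<^sub>E {0..<int n})"
  show "finite ?S"
    by (intro finite_imageI finite_PiE) auto
  show "torsion (torus :: (real ^ 'n) set monoid) n \<subseteq> ?S"
  proof
    fix X :: "(real ^ 'n) set" assume X: "X \<in> torsion torus n"
    then obtain v where "X = torus_proj v"
      by (auto simp: torsion_def carrier_torus)
    then obtain w where w: "X = torus_proj w" "\<And>i. 0 \<le> w $ i" "\<And>i. w $ i < 1"
      using torus_proj_unit_cube by metis
    have "real n *\<^sub>R w \<in> integer_lattice"
      using X w(1) by (simp add: torsion_def pow_torus one_torus torus_proj_eq_iff)
    then have "\<forall>i. \<exists>z. real n * w $ i = real_of_int z"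
      by (auto simp: integer_lattice_def elim: Ints_cases)
    then obtain k where k: "\<And>i. real n * w $ i = real_of_int (k i)"
      by metis
    have "k i \<in> {0..<int n}" for i
    proof -
      have "0 \<le> real n * w $ i" "real n * w $ i < real n"
        using w(2,3)[of i] assms by (auto simp: mult_less_cancel_left2)
      then show ?thesis
        unfolding k by simp
    qed
    moreover have "w = (\<chi> i. real_of_int (k i) / real n)"
      using assms by (simp add: vec_eq_iff flip: k)
    ultimately show "X \<in> ?S"
      unfolding w(1) by (auto intro!: image_eqI[of _ _ k])
  qed
qed

lemma map_matrix_of_int_mult:
  "map_matrix real_of_int (A ** B) = map_matrix real_of_int A ** map_matrix real_of_int B"
  by (simp add: vec_eq_iff matrix_matrix_mult_def)

lemma toral_map_mult:
  assumes "X \<in> carrier torus"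
  shows "toral_map A (toral_map B X) = toral_map (A ** B) X"
  using assms
  by (auto simp: carrier_torus toral_map_proj map_matrix_of_int_mult matrix_vector_mul_assoc)

lemma toral_map_mat_1:
  fixes X :: "(real ^ 'n) set"
  assumes "X \<in> carrier torus"
  shows "toral_map (mat 1) X = X"
proof -
  have "map_matrix real_of_int (mat 1 :: int ^ 'n ^ 'n) = mat 1"
    by (simp add: vec_eq_iff mat_def)
  then show ?thesis
    using assms by (auto simp: carrier_torus toral_map_proj)
qed

lemma toral_map_in_carrier: "X \<in> carrier torus \<Longrightarrow> toral_map A X \<in> carrier torus"
  by (auto simp: carrier_torus toral_map_proj)

lemma topological_automorphism_toral_map:
  fixes A :: "int ^ 'n ^ 'n"
  assumes "invertible A"
  shows "topological_automorphism torus torus_topology (toral_map A)"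
proof -
  obtain A' where A': "A ** A' = mat 1" "A' ** A = mat 1"
    using assms by (auto simp: invertible_def)
  have "toral_map A \<in> hom torus torus"
    by (rule homI)
      (auto simp: toral_map_in_carrier, auto simp: carrier_torus mult_torus toral_map_proj
        matrix_vector_right_distrib)
  moreover have "bij_betw (toral_map A) (carrier torus) (carrier torus)"
    by (rule bij_betw_byWitness[of _ "toral_map A'"])
      (auto simp: toral_map_mult A' toral_map_mat_1 toral_map_in_carrier)
  moreover have "continuous_map torus_topology torus_topology (toral_map A)"
  proof (rule continuous_compose_quotient_map[OF quotient_map_torus_proj])
    have "continuous_map euclidean euclidean (\<lambda>v. map_matrix real_of_int A *v v)"
      by (simp add: matrix_vector_mult_linear_continuous_on)
    from continuous_map_compose[OF this quotient_imp_continuous_map[OF quotient_map_torus_proj]]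
    show "continuous_map euclidean torus_topology (toral_map A \<circ> torus_proj)"
      by (simp add: o_def toral_map_proj)
  qed
  ultimately show ?thesis
    by (simp add: topological_automorphism_def iso_def)
qed


section \<open>Doubly invariant finite subgroups of the torus\<close>

theorem theorem3p3:
  fixes A :: "int ^ 'n ^ 'n"
  assumes "invertible A"
  shows "toral_graph A \<in> finite_to_one_correspondences torus torus_topology \<and>
    (\<forall>H. subgroup H torus \<and> finite H \<longrightarrow>
      (\<exists>H'. subgroup H' torus \<and> finite H' \<and> H \<subseteq> H' \<and>
        doubly_invariant torus torus_topology (toral_graph A) H' \<and>
        (\<exists>B. topological_automorphism (torus Mod H') (quotient_topology torus torus_topology H') B \<and>
             factor_correspondence torus (toral_graph A) H' = graph_of (torus Mod H') B) \<and>
        is_factor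
          (torus Mod H) (quotient_topology torus torus_topology H)
          (factor_correspondence torus (toral_graph A) H)
          torus torus_topology (toral_graph A) \<and>
        is_factor
          (torus Mod H') (quotient_topology torus torus_topology H')
          (factor_correspondence torus (toral_graph A) H')
          (torus Mod H) (quotient_topology torus torus_topology H)
          (factor_correspondence torus (toral_graph A) H)))"
proof (intro conjI allI impI)
  have aut: "topological_automorphism torus torus_topology (toral_map A)"
    using assms by (rule topological_automorphism_toral_map)
  show fin: "toral_graph A \<in> finite_to_one_correspondences torus torus_topology"
    unfolding toral_graph_def using compact_group_torus aut
    by (rule graph_in_finite_to_one_correspondences)
  then have cor: "correspondence torus torus_topology (toral_graph A)"
    by (simp add: finite_to_one_correspondences_def)
  interpret T: comm_group "torus :: (real ^ 'n) set monoid"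
    by (rule comm_group_torus)
  fix H :: "(real ^ 'n) set set"
  assume H: "subgroup H torus \<and> finite H"
  define K where "K = torsion (torus :: (real ^ 'n) set monoid) (card H)"
  have K: "subgroup K torus"
    unfolding K_def by (rule T.subgroup_torsion)
  have HK: "H \<subseteq> K"
    unfolding K_def using H by (simp add: T.subgroup_subset_torsion)
  have "card H > 0"
    using H by (auto simp: card_gt_0_iff dest: subgroup.one_closed)
  then have finK: "finite K"
    unfolding K_def by (rule finite_torsion_torus)
  have normal: "N \<lhd> torus" if "subgroup N torus" for N :: "(real ^ 'n) set set"
    using that by (simp add: T.normal_iff_subgroup)
  have closed: "closedin torus_topology N" if "subgroup N torus" "finite N"
    for N :: "(real ^ 'n) set set"
    using that compact_group_torus
    by (intro closedin_Hausdorff_finite)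
      (auto simp: compact_group_def compact_group_axioms_def topspace_torus_topology
        dest: subgroup.subset)
  have inv: "doubly_invariant torus torus_topology (toral_graph A) K"
    unfolding toral_graph_def
  proof (rule doubly_invariant_graph)
    show "topological_group torus torus_topology"
      using compact_group_torus by (rule compact_group.axioms)
    show "toral_map A ` K = K"
      unfolding K_def using aut
      by (intro image_torsion) (auto simp: topological_automorphism_def T.is_group)
  qed (use aut K finK normal closed in auto)
  show "\<exists>H'. subgroup H' torus \<and> finite H' \<and> H \<subseteq> H' \<and>
        doubly_invariant torus torus_topology (toral_graph A) H' \<and>
        (\<exists>B. topological_automorphism (torus Mod H') (quotient_topology torus torus_topology H') B \<and>
             factor_correspondence torus (toral_graph A) H' = graph_of (torus Mod H') B) \<and>
        is_factor
          (torus Mod H) (quotient_topology torus torus_topology H)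
          (factor_correspondence torus (toral_graph A) H)
          torus torus_topology (toral_graph A) \<and>
        is_factor
          (torus Mod H') (quotient_topology torus torus_topology H')
          (factor_correspondence torus (toral_graph A) H')
          (torus Mod H) (quotient_topology torus torus_topology H)
          (factor_correspondence torus (toral_graph A) H)"
  proof (intro exI[of _ K] conjI)
    show "\<exists>B. topological_automorphism (torus Mod K) (quotient_topology torus torus_topology K) B \<and>
        factor_correspondence torus (toral_graph A) K = graph_of (torus Mod K) B"
      using inv by (simp add: doubly_invariant_def)
    show "is_factor (torus Mod H) (quotient_topology torus torus_topology H)
        (factor_correspondence torus (toral_graph A) H) torus torus_topology (toral_graph A)"
      using cor H by (intro is_factor_quotient normal closed) auto
    show "is_factor (torus Mod K) (quotient_topology torus torus_topology K)
        (factor_correspondence torus (toral_graph A) K)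
        (torus Mod H) (quotient_topology torus torus_topology H)
        (factor_correspondence torus (toral_graph A) H)"
      using cor H K finK HK by (intro is_factor_quotient_quotient normal closed) auto
  qed (use K finK HK inv in auto)
qed

end
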